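(* Let $G$ be a finite abelian group. Then $S(G)\geq |G|$, and equality $S(G)=|G|$ holds if and only if $G$ is cyclic.
   Context: For a finite group $H$, let $\exp(H)$ denote the exponent of $H$ (the least positive integer $e$ with $a^e=1$ for all $a\in H$), let $o(a)$ denote the order of $a\in H$, and define $\varphi(H)=|\{a\in H \mid o(a)=\exp(H)\}|$. For a finite group $G$, define $S(G)=\sum_{H\leq G}\varphi(H)$, where the sum runs over all subgroups $H$ of $G$ (including the trivial subgroup and $G$ itself). *)

theory Defs
  imports "HOL-Algebra.Algebra"
begin

(* The exponent is used for finite groups only: for a group of infinite exponent
   no candidate exists and LEAST is unspecified. *)
definition group_exponent :: "('a, 'b) monoid_scheme \<Rightarrow> nat"
  where "group_exponent H = (LEAST e. 0 < e \<and> (\<forall>a\<in>carrier H. a [^]\<^bsub>H\<^esub> e = \<one>\<^bsub>H\<^esub>))"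

definition varphi :: "('a, 'b) monoid_scheme \<Rightarrow> nat"
  where "varphi H = card {a \<in> carrier H. group.ord H a = group_exponent H}"

definition subgroup_sum :: "('a, 'b) monoid_scheme \<Rightarrow> nat"
  where "subgroup_sum G = (\<Sum>H | subgroup H G. varphi (G\<lparr>carrier := H\<rparr>))"

end

(* Exchanging the order of summation, subgroup_sum G counts, for each a in G, the subgroups H
   containing a with exponent ord a. The subgroup generated by a is always among them, which gives
   the inequality, with equality iff it is the only one for every a. If G is abelian, some a attains
   the exponent of G, so H = G also qualifies and equality forces G to be generated by a.
   Conversely, if G is cyclic and d divides its order, the equation h^d = 1 has at most d solutions,
   so a subgroup H with exponent ord a has at most ord a elements. *)

theory Submission
  imports Defs
begin

text \<open>The order of \<open>G\<close> kills every element, so \<open>LEAST\<close> has a witness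
  and the exponent is a positive multiple of \<open>ord a\<close>. If \<open>ord a\<close> kills
  every element too, minimality of the exponent forces equality.\<close>

lemma (in group) ord_eq_group_exponent_iff:
  assumes "finite (carrier G)" and a: "a \<in> carrier G"
  shows "ord a = group_exponent G \<longleftrightarrow> (\<forall>h\<in>carrier G. h [^] ord a = \<one>)"
proof -
  define P where "P e \<longleftrightarrow> 0 < e \<and> (\<forall>h\<in>carrier G. h [^] e = \<one>)" for e :: nat
  have "P (order G)"
    using assms by (simp add: P_def order_gt_0_iff_finite pow_order_eq_1)
  then have exp: "P (group_exponent G)"
    unfolding group_exponent_def P_def by (rule LeastI)
  then have "ord a \<le> group_exponent G"
    using a by (simp add: P_def pow_eq_id dvd_imp_le)
  moreover have "group_exponent G \<le> ord a" if "\<forall>h\<in>carrier G. h [^] ord a = \<one>"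
    unfolding group_exponent_def
    using that ord_ge_1[OF assms] by (intro Least_le) simp
  ultimately show ?thesis
    using exp by (auto simp: P_def)
qed

lemma (in group) ord_mult_coprime:
  assumes comm: "x \<otimes> y = y \<otimes> x" and xy: "x \<in> carrier G" "y \<in> carrier G"
    and cop: "coprime (ord x) (ord y)"
  shows "ord (x \<otimes> y) = ord x * ord y"
proof (rule dvd_antisym)
  define d where "d = ord (x \<otimes> y)"
  \<comment> \<open>Taking \<open>k = ord y\<close> removes \<open>y\<close>, so
    \<open>ord x\<close> divides \<open>d * ord y\<close>, hence \<open>d\<close> by coprimality;
    \<open>k = ord x\<close> does the same for \<open>y\<close>.\<close>
  have pow: "x [^] (d * k) \<otimes> y [^] (d * k) = \<one>" for k
  proof -
    have "(x \<otimes> y) [^] (d * k) = \<one>"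
      using xy by (simp add: pow_eq_id d_def)
    then show ?thesis
      using pow_mult_distrib[OF comm xy] by simp
  qed
  have "x [^] (d * ord y) = \<one>"
    using pow[of "ord y"] xy pow_eq_id[of y "d * ord y"] by simp
  then have "ord x dvd d"
    using xy cop by (simp add: pow_eq_id coprime_dvd_mult_left_iff)
  moreover have "y [^] (d * ord x) = \<one>"
    using pow[of "ord x"] xy pow_eq_id[of x "d * ord x"] by simp
  then have "ord y dvd d"
    using xy cop by (simp add: pow_eq_id coprime_dvd_mult_left_iff coprime_commute)
  ultimately show "ord x * ord y dvd ord (x \<otimes> y)"
    using cop by (simp add: d_def divides_mult)
qed (rule ord_mul_divides[OF comm xy])

text \<open>An element \<open>a\<close> of maximal order works: if a prime \<open>p\<close> occurred
  in some \<open>ord b\<close> to a higher power than in \<open>ord a\<close>, exchanging the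
  \<open>p\<close>-part of \<open>a\<close> for that of \<open>b\<close> would give an element of
  larger order.\<close>

lemma (in comm_group) ord_eq_group_exponent_exists:
  assumes fin: "finite (carrier G)"
  obtains a where "a \<in> carrier G" "ord a = group_exponent G"
proof -
  have "Max (ord ` carrier G) \<in> ord ` carrier G"
    using fin carrier_not_empty by (intro Max_in) auto
  then obtain a where a: "a \<in> carrier G" and "ord a = Max (ord ` carrier G)"
    by fastforce
  then have max: "ord b \<le> ord a" if "b \<in> carrier G" for b
    using that fin by simp
  have "ord b dvd ord a" if b: "b \<in> carrier G" for b
  proof (rule multiplicity_le_imp_dvd)
    show "ord b \<noteq> 0"
      using ord_ge_1[OF fin b] by simp
    fix p :: nat
    assume p: "Factorial_Ring.prime p"
    define i j where "i = multiplicity p (ord a)" and "j = multiplicity p (ord b)"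
    have a0: "ord a \<noteq> 0"
      using ord_ge_1[OF fin a] by simp
    obtain m where m: "ord a = p ^ i * m" "\<not> p dvd m"
      using multiplicity_decompose'[of "ord a" p] a0 p unfolding i_def
      by (metis not_prime_unit)
    obtain n where n: "ord b = p ^ j * n" "\<not> p dvd n"
      using multiplicity_decompose'[of "ord b" p] \<open>ord b \<noteq> 0\<close> p unfolding j_def
      by (metis not_prime_unit)
    have "p \<noteq> 0" "n \<noteq> 0" "m \<noteq> 0"
      using p n m by (auto intro: ccontr)
    \<comment> \<open>The power \<open>p ^ i\<close> strips the \<open>p\<close>-part from
      \<open>a\<close>, and the power \<open>n\<close> keeps only the \<open>p\<close>-part of
      \<open>b\<close>. The two orders are coprime, so they multiply.\<close>
    have orda: "ord (a [^] (p ^ i)) = m"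
      using a m \<open>p \<noteq> 0\<close> by (simp add: ord_pow)
    have ordb: "ord (b [^] n) = p ^ j"
      using b n \<open>n \<noteq> 0\<close> by (simp add: ord_pow)
    have "coprime m (p ^ j)"
      using prime_imp_coprime[OF p m(2)] by (simp add: coprime_commute)
    then have "ord (a [^] (p ^ i) \<otimes> b [^] n) = m * p ^ j"
      using a b orda ordb ord_mult_coprime[of "a [^] (p ^ i)" "b [^] n"] by (simp add: m_comm)
    moreover have "ord (a [^] (p ^ i) \<otimes> b [^] n) \<le> ord a"
      using a b by (simp add: max)
    ultimately have "p ^ j \<le> p ^ i"
      using m(1) \<open>m \<noteq> 0\<close> by (simp add: mult.commute)
    then show "multiplicity p (ord b) \<le> multiplicity p (ord a)"
      unfolding i_def j_def using prime_gt_1_nat[OF p] by (rule power_le_imp_le_exp[rotated])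
  qed
  then have "ord a = group_exponent G"
    using ord_eq_group_exponent_iff[OF fin a] by (simp add: pow_eq_id)
  with a that show thesis by blast
qed

text \<open>These are the subgroups containing \<open>a\<close> whose exponent is
  \<open>ord a\<close>, when \<open>G\<close> is finite and \<open>a\<close> lies in it. The
  condition uses powers in \<open>G\<close> only, so it needs no change of carrier.\<close>

definition exponent_subgroups :: "('a, 'b) monoid_scheme \<Rightarrow> 'a \<Rightarrow> 'a set set"
  where "exponent_subgroups G a =
    {H. subgroup H G \<and> a \<in> H \<and> (\<forall>h\<in>H. h [^]\<^bsub>G\<^esub> group.ord G a = \<one>\<^bsub>G\<^esub>)}"

context group
begin

lemma finite_subgroups:
  assumes "finite (carrier G)"
  shows "finite {H. subgroup H G}"
  using assms by (rule finite_subset[rotated, OF finite_Pow_iff[THEN iffD2]])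
    (auto dest: subgroup.subset)

text \<open>Powers, and hence orders, computed in \<open>H\<close> agree with those in
  \<open>G\<close>. With \<open>varphi\<close> written as a count over \<open>carrier G\<close>, the
  double sum can be swapped.\<close>

lemma varphi_subgroup:
  assumes fin: "finite (carrier G)" and H: "subgroup H G"
  shows "varphi (G\<lparr>carrier := H\<rparr>) = card {a \<in> carrier G. H \<in> exponent_subgroups G a}"
proof -
  interpret H: group "G\<lparr>carrier := H\<rparr>"
    using H is_group by (rule subgroup.subgroup_is_group)
  have sub: "H \<subseteq> carrier G"
    using H by (rule subgroup.subset)
  have ord: "H.ord a = ord a" for a
    by (simp add: H.ord_def ord_def flip: nat_pow_consistent)
  have "H.ord a = group_exponent (G\<lparr>carrier := H\<rparr>) \<longleftrightarrow> (\<forall>h\<in>H. h [^] ord a = \<one>)"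
    if "a \<in> H" for a
    using H.ord_eq_group_exponent_iff[of a] that finite_subset[OF sub fin]
    by (simp add: ord flip: nat_pow_consistent)
  then show ?thesis
    unfolding varphi_def exponent_subgroups_def
    using H sub by (intro arg_cong[where f = card]) auto
qed

lemma subgroup_sum_eq:
  assumes fin: "finite (carrier G)"
  shows "subgroup_sum G = (\<Sum>a\<in>carrier G. card (exponent_subgroups G a))"
proof -
  have "subgroup_sum G =
      (\<Sum>H | subgroup H G. \<Sum>a | a \<in> carrier G \<and> H \<in> exponent_subgroups G a. 1)"
    unfolding subgroup_sum_def by (intro sum.cong) (simp_all add: varphi_subgroup fin)
  also have "\<dots> = (\<Sum>a\<in>carrier G. \<Sum>H | H \<in> {H. subgroup H G} \<and> H \<in> exponent_subgroups G a. 1)"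
    by (rule sum.swap_restrict) (simp_all add: finite_subgroups fin)
  also have "\<dots> = (\<Sum>a\<in>carrier G. card (exponent_subgroups G a))"
    by (intro sum.cong) (auto simp: exponent_subgroups_def intro: arg_cong[where f = card])
  finally show ?thesis .
qed

lemma generate_in_exponent_subgroups:
  assumes a: "a \<in> carrier G"
  shows "generate G {a} \<in> exponent_subgroups G a"
proof -
  have "(a [^] k) [^] ord a = \<one>" for k :: int
  proof -
    have "(a [^] k) [^] ord a = a [^] (k * int (ord a))"
      using a by (metis int_pow_int int_pow_pow)
    then show ?thesis
      using a by (simp add: int_pow_eq_id)
  qed
  then show ?thesis
    using a generate_is_subgroup[of "{a}"] generate.incl[of a "{a}" G]
    by (auto simp: exponent_subgroups_def generate_pow)
qed

lemma exponent_subgroups_cyclic: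
  assumes fin: "finite (carrier G)" and cyc: "cyclic_group G" and a: "a \<in> carrier G"
  shows "exponent_subgroups G a = {generate G {a}}"
proof -
  obtain g where g: "g \<in> carrier G" and G: "carrier G = range (\<lambda>n::int. g [^] n)"
    using cyc cyclic_group by blast
  have gen: "carrier G = generate G {g}"
    using g G by (auto simp: generate_pow)
  have "ord g = order G"
    using generate_pow_card[OF g] gen by (simp add: order_def)
  then have "ord a dvd ord g"
    using a by (simp add: ord_dvd_group_order)
  then obtain q where q: "ord g = q * ord a"
    by (metis dvdE mult.commute)
  have pos: "ord g > 0" "ord a > 0"
    using ord_ge_1[OF fin] g a by (auto simp: Suc_le_eq)
  \<comment> \<open>The cyclic subgroup of \<open>s\<close> has \<open>ord a\<close> elements and
    contains every solution of \<open>h [^] ord a = \<one>\<close>, so it bounds every candidate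
    \<open>H\<close> from above.\<close>
  define s where "s = g [^] q"
  have s: "s \<in> carrier G" "ord s = ord a"
    using g q pos by (auto simp: s_def ord_pow)
  have "H = generate G {a}" if H: "H \<in> exponent_subgroups G a" for H
  proof -
    have sub: "subgroup H G" and aH: "a \<in> H" and one: "\<And>h. h \<in> H \<Longrightarrow> h [^] ord a = \<one>"
      using H by (auto simp: exponent_subgroups_def)
    have HG: "H \<subseteq> carrier G"
      using sub by (rule subgroup.subset)
    have "H \<subseteq> generate G {s}"
    proof
      fix h
      assume h: "h \<in> H"
      then obtain k :: int where k: "h = g [^] k"
        using G HG by blast
      have "g [^] (k * int (ord a)) = \<one>"
        using one[OF h] g k by (metis int_pow_int int_pow_pow)
      \<comment> \<open>\<open>ord g = q * ord a\<close> divides \<open>k * ord a\<close>, and the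
        positive factor \<open>ord a\<close> cancels.\<close>
      then have "int q dvd k"
        using g q pos by (simp add: int_pow_eq_id)
      then obtain l where l: "k = int q * l"
        by (elim dvdE)
      have "h = s [^] l"
        using g k l by (simp add: s_def int_pow_pow flip: int_pow_int)
      then show "h \<in> generate G {s}"
        using s by (auto simp: generate_pow)
    qed
    moreover have "finite (generate G {s})"
      using s pos by (auto simp: generate_pow_card intro: card_ge_0_finite)
    ultimately have "card H \<le> ord a"
      using card_mono s generate_pow_card by metis
    moreover have "generate G {a} \<subseteq> H"
      using aH sub by (simp add: generate_subgroup_incl)
    \<comment> \<open>\<open>generate G {a}\<close> has exactly \<open>ord a\<close> elements and
      lies inside \<open>H\<close>, which has at most that many.\<close>
    ultimately show ?thesis
      using card_seteq[of H "generate G {a}"] finite_subset[OF HG fin] a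
      by (simp add: generate_pow_card)
  qed
  then show ?thesis
    using generate_in_exponent_subgroups[OF a] by blast
qed

end

theorem theorem3:
  fixes G :: "('a, 'b) monoid_scheme"
  assumes "comm_group G" and "finite (carrier G)"
  shows "order G \<le> subgroup_sum G \<and> (subgroup_sum G = order G \<longleftrightarrow> cyclic_group G)"
proof -
  interpret comm_group G by fact
  note fin = assms(2)
  let ?E = "exponent_subgroups G"
  have finE: "finite (?E a)" for a
    using finite_subgroups[OF fin] by (rule finite_subset[rotated]) (auto simp: exponent_subgroups_def)
  have ge: "1 \<le> card (?E a)" if "a \<in> carrier G" for a
    using generate_in_exponent_subgroups[OF that] finE[of a]
    by (metis One_nat_def Suc_leI card_gt_0_iff empty_iff)
  have order: "order G = (\<Sum>a\<in>carrier G. 1)"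
    by (simp add: order_def)
  have "order G \<le> subgroup_sum G"
    unfolding order subgroup_sum_eq[OF fin] by (intro sum_mono ge)
  moreover have "cyclic_group G" if eq: "subgroup_sum G = order G"
  proof -
    obtain a where a: "a \<in> carrier G" and exp: "ord a = group_exponent G"
      using ord_eq_group_exponent_exists[OF fin] .
    \<comment> \<open>Every term of the sum is at least 1, so equality of the totals forces equality
      term by term.\<close>
    have "1 = card (?E a)"
      using eq a ge fin unfolding order subgroup_sum_eq[OF fin]
      by (intro sum_mono_inv[where I = "carrier G" and f = "\<lambda>_. 1"]) auto
    \<comment> \<open>Since \<open>a\<close> attains the exponent, the whole group competes with
      \<open>generate G {a}\<close> for the single place in \<open>?E a\<close>.\<close>
    moreover have "carrier G \<in> ?E a"
      using a exp ord_eq_group_exponent_iff[OF fin a] subgroup_self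
      by (simp add: exponent_subgroups_def)
    ultimately have "carrier G = generate G {a}"
      using generate_in_exponent_subgroups[OF a] by (metis card_1_singletonE singletonD)
    then show ?thesis
      using a by (auto simp: cyclic_group generate_pow)
  qed
  moreover have "subgroup_sum G = order G" if "cyclic_group G"
    using exponent_subgroups_cyclic[OF fin that] by (simp add: subgroup_sum_eq[OF fin] order)
  ultimately show ?thesis by blast
qed

end
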